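(* Let $k,\rho,c,\lambda,\Theta_\infty,h>0$ be constants and set $\alpha=\frac{k}{\rho c}$, $\mathrm{Ste}=\frac{c\Theta_\infty}{\lambda}$, $\mathrm{Bi}=\frac{h\sqrt{\alpha}}{k}$. Then the polynomial equation $$\mathrm{Ste}\,z^{4}-\frac{1}{\mathrm{Bi}}z^{3}-6(1+\mathrm{Ste})z^2-\frac{3}{\mathrm{Bi}}z+9\mathrm{Ste}=0$$ has exactly one solution $z=\xi_4$ in the interval $0<z<\sqrt{3}$; the constants $$A_{4}=\frac{2\xi_{4}(3-\xi_4^{2})}{\frac{1}{\mathrm{Bi}}\xi_{4}^{2}+6\xi_{4}+\frac{3}{\mathrm{Bi}}},\qquad B_{4}=\frac{2\xi_{4}^{3}}{\frac{1}{\mathrm{Bi}}\xi_{4}^{2}+6\xi_{4}+\frac{3}{\mathrm{Bi}}}$$ are positive; and the (unique) solution of Problem (P4) for a quadratic profile in space is $$T_{4}(x,t)=-A_{4}\Theta_{\infty}\left(1-\frac{x}{s_{4}(t)}\right)-B_{4}\Theta_{\infty}\left(1-\frac{x}{s_{4}(t)}\right)^{2},\qquad s_{4}(t)=2\xi_{4}\sqrt{\alpha t}.$$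
   Context: Problem (P4): find $s_4=s_4(t)$ and $T_4=T_4(x,t)$, defined for $0\le x\le s_4(t)$, $t>0$, such that - $\displaystyle\int_0^{s_{4}(t)}\int_0^x\frac{\partial T_4}{\partial t}(\eta,t)\,d\eta\,dx=-\dfrac{k}{\rho c}\left[T_{4}(0,t)+\dfrac{\partial T_4}{\partial x}(0,t)\,s_{4}(t)\right]$, $t>0$; - $k\dfrac{\partial T_4}{\partial x}(0,t)=\dfrac{h}{\sqrt{t}}\left(T_{4}(0,t)+\Theta_{\infty}\right)$, $t>0$; - $T_{4}(s_{4}(t),t)=0$, $t>0$; - $\left(\dfrac{\partial T_4}{\partial x}(s_{4}(t),t)\right)^2=-\dfrac{\lambda}{c}\dfrac{\partial^2 T_4}{\partial x^2}(s_{4}(t),t)$, $t>0$; - $s_{4}(0)=0$. A solution "for a quadratic profile in space" is a solution pair $(T_4,s_4)$ in which $T_4(x,t)=-A\Theta_\infty\left(1-\frac{x}{s_4(t)}\right)-B\Theta_\infty\left(1-\frac{x}{s_4(t)}\right)^2$ for some constants $A>0$, $B>0$, with $s_4$ continuous on $[0,\infty)$, continuously differentiable and positive on $(0,\infty)$. *)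

theory Defs
  imports "HOL-Analysis.Analysis"
begin

text \<open>
  The temperature \<open>T x t\<close> and the free boundary \<open>s t\<close> are total functions, but only the values of
  \<open>T\<close> on the region \<open>0 \<le> x \<le> s t\<close>, \<open>0 < t\<close>, and of \<open>s\<close> on \<open>0 \<le> t\<close> are meaningful.
  The functions \<open>Tx\<close>, \<open>Txx\<close> and \<open>Tt\<close> below are the partial derivatives of \<open>T\<close> taken within that
  region (hence one-sided in \<open>x\<close> at \<open>x = 0\<close> and \<open>x = s t\<close>).
  At \<open>x = s t\<close> the time slice of the region may reduce to the single point \<open>t\<close>, which leaves
  \<open>Tt (s t) t\<close> unconstrained; this does not affect the integrals.
  Integrability of \<open>\<lambda>\<eta>. Tt \<eta> t\<close> on \<open>{0..s t}\<close> makes the inner integral below exist for every \<open>x\<close>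
  and depend continuously on \<open>x\<close>, so that the outer integral exists as well.
\<close>

definition problem_P4 ::
  "real \<Rightarrow> real \<Rightarrow> real \<Rightarrow> real \<Rightarrow> real \<Rightarrow> real \<Rightarrow> (real \<Rightarrow> real \<Rightarrow> real) \<Rightarrow> (real \<Rightarrow> real) \<Rightarrow> bool"
  where
  "problem_P4 k \<rho> c lam \<Theta> h T s \<longleftrightarrow>
    (\<exists>Tx Txx Tt.
      (\<forall>t>0. \<forall>x\<in>{0..s t}.
         ((\<lambda>y. T y t) has_real_derivative Tx x t) (at x within {0..s t}) \<and>
         ((\<lambda>y. Tx y t) has_real_derivative Txx x t) (at x within {0..s t}) \<and>
         ((\<lambda>\<tau>. T x \<tau>) has_real_derivative Tt x t) (at t within {\<tau>. 0 < \<tau> \<and> x \<le> s \<tau>})) \<and>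
      (\<forall>t>0. (\<lambda>\<eta>. Tt \<eta> t) integrable_on {0..s t} \<and>
         integral {0..s t} (\<lambda>x. integral {0..x} (\<lambda>\<eta>. Tt \<eta> t))
           = - (k / (\<rho> * c)) * (T 0 t + Tx 0 t * s t)) \<and>
      (\<forall>t>0. k * Tx 0 t = h / sqrt t * (T 0 t + \<Theta>)) \<and>
      (\<forall>t>0. T (s t) t = 0) \<and>
      (\<forall>t>0. (Tx (s t) t)\<^sup>2 = - (lam / c) * Txx (s t) t) \<and>
      s 0 = 0)"

definition quadratic_profile ::
  "real \<Rightarrow> real \<Rightarrow> real \<Rightarrow> (real \<Rightarrow> real) \<Rightarrow> real \<Rightarrow> real \<Rightarrow> real"
  where
  "quadratic_profile \<Theta> A B s x t = - A * \<Theta> * (1 - x / s t) - B * \<Theta> * (1 - x / s t)\<^sup>2"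

definition quadratic_solution_P4 ::
  "real \<Rightarrow> real \<Rightarrow> real \<Rightarrow> real \<Rightarrow> real \<Rightarrow> real \<Rightarrow> (real \<Rightarrow> real \<Rightarrow> real) \<Rightarrow> (real \<Rightarrow> real) \<Rightarrow> bool"
  where
  "quadratic_solution_P4 k \<rho> c lam \<Theta> h T s \<longleftrightarrow>
    continuous_on {0..} s \<and> s C1_differentiable_on {0<..} \<and> (\<forall>t>0. 0 < s t) \<and>
    (\<exists>A>0. \<exists>B>0. \<forall>t>0. \<forall>x\<in>{0..s t}. T x t = quadratic_profile \<Theta> A B s x t) \<and>
    problem_P4 k \<rho> c lam \<Theta> h T s"

definition quartic_P4 :: "real \<Rightarrow> real \<Rightarrow> real \<Rightarrow> real"
  where
  "quartic_P4 Ste Bi z =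
    Ste * z ^ 4 - 1 / Bi * z ^ 3 - 6 * (1 + Ste) * z\<^sup>2 - 3 / Bi * z + 9 * Ste"

end

theory Submission
  imports Defs
begin

text \<open>
  For a quadratic profile the Robin condition forces \<open>s t = m * sqrt t\<close>, because every other
  quantity in it is constant in time. The remaining conditions then become algebraic in
  \<open>A\<close>, \<open>B\<close> and \<open>\<xi> = m / (2 * sqrt \<alpha>)\<close>: the double integral gives \<open>\<xi>\<^sup>2 (A + B) = 3 B\<close>, the Robin
  condition \<open>A + 2 B = 2 Bi \<xi> (1 - A - B)\<close>, and the condition at the free boundary
  \<open>Ste A\<^sup>2 = 2 B\<close>. The first two determine \<open>A\<close> and \<open>B\<close> from \<open>\<xi>\<close>, and the third becomes the quartic,
  which is \<open>Ste (3 - z\<^sup>2)\<^sup>2 - (z\<^sup>3 + 3 z) / Bi - 6 z\<^sup>2\<close> and hence strictly decreasing on \<open>[0, sqrt 3]\<close>.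
\<close>

section \<open>The quartic and its root between \<open>0\<close> and \<open>sqrt 3\<close>\<close>

lemma quartic_P4_alt:
  "quartic_P4 Ste Bi z = Ste * (3 - z\<^sup>2)\<^sup>2 - (z ^ 3 + 3 * z) / Bi - 6 * z\<^sup>2"
  unfolding quartic_P4_def by (simp add: power2_eq_square power4_eq_xxxx algebra_simps add_divide_distrib)

text \<open>In the regrouped form every summand is nonincreasing, and \<open>- 6 * z^2\<close>
  supplies the strictness. The bound \<open>sqrt 3\<close> keeps \<open>3 - z^2\<close> nonnegative,
  so that squaring it preserves the order.\<close>

lemma quartic_P4_strict_antimono:
  fixes Ste Bi y z :: real
  assumes "Ste > 0" "Bi > 0" "0 \<le> y" "y < z" "z \<le> sqrt 3"
  shows "quartic_P4 Ste Bi z < quartic_P4 Ste Bi y"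
proof -
  have sq: "y\<^sup>2 < z\<^sup>2" "z\<^sup>2 \<le> 3"
    using assms power_strict_mono[of y z 2] power_mono[of z "sqrt 3" 2] by auto
  have "(3 - z\<^sup>2)\<^sup>2 \<le> (3 - y\<^sup>2)\<^sup>2"
    using sq by (intro power_mono) auto
  then have "Ste * (3 - z\<^sup>2)\<^sup>2 \<le> Ste * (3 - y\<^sup>2)\<^sup>2"
    using assms by (intro mult_left_mono) auto
  moreover have "(y ^ 3 + 3 * y) / Bi \<le> (z ^ 3 + 3 * z) / Bi"
    using assms by (intro divide_right_mono add_mono power_mono) auto
  ultimately show ?thesis
    unfolding quartic_P4_alt using sq by linarith
qed

text \<open>The quartic is \<open>9 * Ste\<close> at \<open>0\<close>, while at
  \<open>sqrt 3\<close> its only nonnegative summand \<open>Ste * (3 - z^2)^2\<close> vanishes. The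
  intermediate value theorem gives a root, and strict monotonicity gives its uniqueness.\<close>

lemma quartic_P4_ex1:
  fixes Ste Bi :: real
  assumes "Ste > 0" "Bi > 0"
  shows "\<exists>!z. 0 < z \<and> z < sqrt 3 \<and> quartic_P4 Ste Bi z = 0"
proof -
  have q0: "quartic_P4 Ste Bi 0 > 0"
    using assms by (simp add: quartic_P4_def)
  have "sqrt 3 ^ 3 + 3 * sqrt 3 > 0"
    by (intro add_pos_pos) auto
  then have q3: "quartic_P4 Ste Bi (sqrt 3) < 0"
    using assms by (simp add: quartic_P4_alt)
      (smt (verit) divide_pos_pos)
  have "continuous_on {0..sqrt 3} (quartic_P4 Ste Bi)"
    unfolding quartic_P4_def[abs_def] by (intro continuous_intros)
  then obtain z where z: "0 \<le> z" "z \<le> sqrt 3" "quartic_P4 Ste Bi z = 0"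
    using IVT2'[of "quartic_P4 Ste Bi" "sqrt 3" 0 0] q0 q3 by auto
  show ?thesis
  proof (rule ex1I[of _ z])
    show "0 < z \<and> z < sqrt 3 \<and> quartic_P4 Ste Bi z = 0"
      using z q0 q3 by (metis less_le)
    fix y assume "0 < y \<and> y < sqrt 3 \<and> quartic_P4 Ste Bi y = 0"
    then show "y = z"
      using quartic_P4_strict_antimono[OF assms, of y z] quartic_P4_strict_antimono[OF assms, of z y] z
      by (cases y z rule: linorder_cases) auto
  qed
qed

section \<open>Derivatives and double integral of a quadratic profile\<close>

lemma quadratic_profile_dx:
  assumes "s t \<noteq> 0"
  shows "((\<lambda>y. quadratic_profile \<Theta> A B s y t) has_real_derivative
           \<Theta> * (A + 2 * B * (1 - x / s t)) / s t) (at x within S)"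
  unfolding quadratic_profile_def
  by (rule derivative_eq_intros refl | use assms in \<open>simp add: field_simps\<close>)+

lemma quadratic_profile_dxx:
  fixes s :: "real \<Rightarrow> real"
  assumes "s t \<noteq> 0"
  shows "((\<lambda>y. \<Theta> * (A + 2 * B * (1 - y / s t)) / s t) has_real_derivative
           - 2 * B * \<Theta> / (s t)\<^sup>2) (at x within S)"
  by (rule derivative_eq_intros refl | use assms in \<open>simp add: field_simps power2_eq_square\<close>)+

text \<open>The derivative is sorted by powers of \<open>x\<close>, with no constant term: this is
  the shape of integrand for which the double integral is computed below.\<close>

lemma quadratic_profile_dt:
  assumes "(s has_real_derivative s') (at t)" "s t \<noteq> 0"
  shows "((\<lambda>\<tau>. quadratic_profile \<Theta> A B s x \<tau>) has_real_derivative
           (- (A + 2 * B) * \<Theta> * s' / (s t)\<^sup>2) * x + (2 * B * \<Theta> * s' / (s t) ^ 3) * x\<^sup>2) (at t)"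
  unfolding quadratic_profile_def
  by (rule derivative_eq_intros refl assms | use assms in \<open>simp add: field_simps power2_eq_square power3_eq_cube\<close>)+

text \<open>The formula for \<open>g\<close> is assumed only for \<eta> strictly below
  \<open>L\<close>, since the time derivative at the free boundary itself may be unconstrained. One
  point does not change the integrals.\<close>

lemma double_integral_quadratic:
  fixes a b L :: real
  assumes "0 \<le> L" and g: "\<And>\<eta>. 0 \<le> \<eta> \<Longrightarrow> \<eta> < L \<Longrightarrow> g \<eta> = a * \<eta> + b * \<eta>\<^sup>2"
  shows "g integrable_on {0..L}"
    and "integral {0..L} (\<lambda>x. integral {0..x} g) = a * L ^ 3 / 6 + b * L ^ 4 / 12"
proof -
  have inner: "(g has_integral (a * x\<^sup>2 / 2 + b * x ^ 3 / 3)) {0..x}" if "0 \<le> x" "x \<le> L" for x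
  proof -
    have "((\<lambda>\<eta>. a * \<eta> + b * \<eta>\<^sup>2) has_integral
            (a * x\<^sup>2 / 2 + b * x ^ 3 / 3) - (a * 0\<^sup>2 / 2 + b * 0 ^ 3 / 3)) {0..x}"
      by (rule fundamental_theorem_of_calculus[OF \<open>0 \<le> x\<close>])
        (auto intro!: derivative_eq_intros simp: has_real_derivative_iff_has_vector_derivative[symmetric])
    moreover have "g \<eta> = a * \<eta> + b * \<eta>\<^sup>2" if "\<eta> \<in> {0..x} - {L}" for \<eta>
      using that \<open>x \<le> L\<close> by (intro g) auto
    ultimately show ?thesis
      using has_integral_spike_finite[of "{L}" "{0..x}" g "\<lambda>\<eta>. a * \<eta> + b * \<eta>\<^sup>2"] by simp
  qed
  show "g integrable_on {0..L}"
    using inner[of L] \<open>0 \<le> L\<close> by (auto simp: integrable_on_def)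
  have "integral {0..L} (\<lambda>x. integral {0..x} g) = integral {0..L} (\<lambda>x. a * x\<^sup>2 / 2 + b * x ^ 3 / 3)"
    by (rule Henstock_Kurzweil_Integration.integral_cong) (use inner in auto)
  also have "((\<lambda>x. a * x\<^sup>2 / 2 + b * x ^ 3 / 3) has_integral
      (a * L ^ 3 / 6 + b * L ^ 4 / 12) - (a * 0 ^ 3 / 6 + b * 0 ^ 4 / 12)) {0..L}"
    by (rule fundamental_theorem_of_calculus[OF \<open>0 \<le> L\<close>])
      (auto intro!: derivative_eq_intros simp: has_real_derivative_iff_has_vector_derivative[symmetric])
  then have "integral {0..L} (\<lambda>x. a * x\<^sup>2 / 2 + b * x ^ 3 / 3) = a * L ^ 3 / 6 + b * L ^ 4 / 12"
    by (simp add: integral_unique)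
  finally show "integral {0..L} (\<lambda>x. integral {0..x} g) = a * L ^ 3 / 6 + b * L ^ 4 / 12" .
qed

text \<open>All powers of \<open>L\<close> cancel except one, so for \<open>L = s t\<close> with
  derivative \<open>s'\<close> the value is a constant multiple of \<open>s' * s t\<close>, half the
  derivative of the square of \<open>s\<close>.\<close>

lemma quadratic_profile_double_integral:
  fixes L s' A B \<Theta> :: real
  assumes "0 < L"
    and "\<And>\<eta>. 0 \<le> \<eta> \<Longrightarrow> \<eta> < L \<Longrightarrow>
      g \<eta> = (- (A + 2 * B) * \<Theta> * s' / L\<^sup>2) * \<eta> + (2 * B * \<Theta> * s' / L ^ 3) * \<eta>\<^sup>2"
  shows "g integrable_on {0..L}"
    and "integral {0..L} (\<lambda>x. integral {0..x} g) = - (A + B) * \<Theta> * s' * L / 6"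
proof -
  show "g integrable_on {0..L}"
    by (rule double_integral_quadratic(1)[where g = g, OF less_imp_le[OF \<open>0 < L\<close>] assms(2)])
  have "integral {0..L} (\<lambda>x. integral {0..x} g) =
      (- (A + 2 * B) * \<Theta> * s' / L\<^sup>2) * L ^ 3 / 6 + (2 * B * \<Theta> * s' / L ^ 3) * L ^ 4 / 12"
    by (rule double_integral_quadratic(2)[where g = g, OF less_imp_le[OF \<open>0 < L\<close>] assms(2)])
  also have "\<dots> = - (A + B) * \<Theta> * s' * L / 6"
    using \<open>0 < L\<close> by (simp add: divide_simps power2_eq_square power3_eq_cube power4_eq_xxxx)
      (simp add: algebra_simps)
  finally show "integral {0..L} (\<lambda>x. integral {0..x} g) = - (A + B) * \<Theta> * s' * L / 6" .
qed

section \<open>From the algebraic system to a solution\<close>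

lemma has_real_derivative_mult_sqrt:
  fixes m t :: real
  assumes "t > 0"
  shows "((\<lambda>t. m * sqrt t) has_real_derivative m / (2 * sqrt t)) (at t)"
  using DERIV_cmult[OF DERIV_real_sqrt[OF assms], of m] by (simp add: field_simps)

text \<open>With \<open>s t = m * sqrt t\<close> the time variable cancels from each condition. The
  assumptions \<open>heat\<close>, \<open>robin\<close> and \<open>stefan\<close> are what remains
  of the integral equation, the Robin condition and the condition at the free boundary.\<close>

lemma quadratic_solution_P4_sqrt:
  fixes k \<rho> c lam \<Theta> h m A B :: real
  assumes pos: "k > 0" "\<rho> > 0" "c > 0" "lam > 0" "\<Theta> > 0" "m > 0" "A > 0" "B > 0"
    and heat: "m\<^sup>2 * (A + B) = 12 * (k / (\<rho> * c)) * B"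
    and robin: "k * (A + 2 * B) = h * m * (1 - A - B)"
    and stefan: "c * \<Theta> * A\<^sup>2 = 2 * lam * B"
  defines "s \<equiv> \<lambda>t. m * sqrt t"
  shows "quadratic_solution_P4 k \<rho> c lam \<Theta> h (quadratic_profile \<Theta> A B s) s"
proof -
  define s' where "s' t = m / (2 * sqrt t)" for t
  have s_pos: "s t > 0" if "t > 0" for t
    using that pos by (simp add: s_def)
  have ds: "(s has_real_derivative s' t) (at t)" if "t > 0" for t
    unfolding s_def s'_def by (rule has_real_derivative_mult_sqrt[OF that])
  define Tx where "Tx x t = \<Theta> * (A + 2 * B * (1 - x / s t)) / s t" for x t
  define Txx where "Txx x t = - 2 * B * \<Theta> / (s t)\<^sup>2" for x t :: real
  define Tt where "Tt x t = (- (A + 2 * B) * \<Theta> * s' t / (s t)\<^sup>2) * x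
    + (2 * B * \<Theta> * s' t / (s t) ^ 3) * x\<^sup>2" for x t
  have "problem_P4 k \<rho> c lam \<Theta> h (quadratic_profile \<Theta> A B s) s"
    unfolding problem_P4_def
  proof (rule exI[of _ Tx], rule exI[of _ Txx], rule exI[of _ Tt], intro conjI allI impI ballI)
    fix t x :: real assume t: "t > 0"
    have st: "s t > 0" "s t \<noteq> 0" using s_pos[OF t] by auto
    show "((\<lambda>y. quadratic_profile \<Theta> A B s y t) has_real_derivative Tx x t) (at x within {0..s t})"
      unfolding Tx_def by (rule quadratic_profile_dx[where s = s and t = t, OF st(2)])
    show "((\<lambda>y. Tx y t) has_real_derivative Txx x t) (at x within {0..s t})"
      unfolding Tx_def Txx_def by (rule quadratic_profile_dxx[where s = s and t = t, OF st(2)])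
    show "((\<lambda>\<tau>. quadratic_profile \<Theta> A B s x \<tau>) has_real_derivative Tt x t)
        (at t within {\<tau>. 0 < \<tau> \<and> x \<le> s \<tau>})"
      unfolding Tt_def by (rule DERIV_subset[OF quadratic_profile_dt[where s = s and t = t, OF ds[OF t] st(2)]]) simp
    show "(\<lambda>\<eta>. Tt \<eta> t) integrable_on {0..s t}"
      by (rule quadratic_profile_double_integral(1)[OF st(1)]) (rule Tt_def)
    have "integral {0..s t} (\<lambda>x. integral {0..x} (\<lambda>\<eta>. Tt \<eta> t)) = - (A + B) * \<Theta> * s' t * s t / 6"
      by (rule quadratic_profile_double_integral(2)[OF st(1)]) (rule Tt_def)
    \<comment> \<open>The product \<open>s' t * s t\<close> is the constant
      \<open>m^2 / 2\<close>.\<close>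
    also have "\<dots> = - \<Theta> / 12 * (m\<^sup>2 * (A + B))"
      using t by (simp add: s_def s'_def power2_eq_square) (simp add: algebra_simps)
    also have "\<dots> = - (k / (\<rho> * c)) * (\<Theta> * B)"
      unfolding heat by simp
    also have "\<Theta> * B = quadratic_profile \<Theta> A B s 0 t + Tx 0 t * s t"
      using st by (simp add: Tx_def quadratic_profile_def) (simp add: algebra_simps)
    finally show "integral {0..s t} (\<lambda>x. integral {0..x} (\<lambda>\<eta>. Tt \<eta> t)) =
        - (k / (\<rho> * c)) * (quadratic_profile \<Theta> A B s 0 t + Tx 0 t * s t)" .
    have "k * Tx 0 t = \<Theta> / s t * (k * (A + 2 * B))"
      by (simp add: Tx_def)
    also have "\<dots> = h / sqrt t * (quadratic_profile \<Theta> A B s 0 t + \<Theta>)"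
      unfolding robin using t pos(6) by (simp add: s_def quadratic_profile_def) (simp add: field_simps)
    finally show "k * Tx 0 t = h / sqrt t * (quadratic_profile \<Theta> A B s 0 t + \<Theta>)" .
    show "quadratic_profile \<Theta> A B s (s t) t = 0"
      using st by (simp add: quadratic_profile_def)
    \<comment> \<open>At the free boundary \<open>Tx\<close> reduces to
      \<open>\<Theta> * A / s t\<close>; its square is factored so that the left side of
      \<open>stefan\<close> appears.\<close>
    have "(Tx (s t) t)\<^sup>2 = \<Theta> / (c * (s t)\<^sup>2) * (c * \<Theta> * A\<^sup>2)"
      using st(2) pos(3) by (simp add: Tx_def power_divide power_mult_distrib) (simp add: power2_eq_square)
    also have "\<dots> = - (lam / c) * Txx (s t) t"
      unfolding stefan by (simp add: Txx_def)
    finally show "(Tx (s t) t)\<^sup>2 = - (lam / c) * Txx (s t) t" .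
  qed (simp add: s_def)
  moreover have "continuous_on {0..} s"
    unfolding s_def by (intro continuous_intros)
  moreover have "s C1_differentiable_on {0<..}"
    unfolding C1_differentiable_on_def
  proof (intro exI[of _ s'] conjI ballI)
    show "(s has_vector_derivative s' t) (at t)" if "t \<in> {0<..}" for t
      using ds[of t] that by (simp add: has_real_derivative_iff_has_vector_derivative)
    show "continuous_on {0<..} s'"
      unfolding s'_def[abs_def] by (intro continuous_intros) auto
  qed
  ultimately show ?thesis
    unfolding quadratic_solution_P4_def using s_pos pos(7,8) by blast
qed

section \<open>From a solution to the algebraic system\<close>

text \<open>The given partial derivatives must agree with those of the profile wherever they are
  used. The Robin condition at all times then determines the shape of \<open>s\<close>; after that,
  evaluating the conditions at time \<open>1\<close> yields the equations for the constants.\<close>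

lemma quadratic_solution_P4E:
  fixes k \<rho> c lam \<Theta> h :: real
  assumes pos: "k > 0" "\<rho> > 0" "c > 0" "lam > 0" "\<Theta> > 0" "h > 0"
    and sol: "quadratic_solution_P4 k \<rho> c lam \<Theta> h T s"
  obtains m A B where "m > 0" "A > 0" "B > 0"
    and "\<And>t. t \<ge> 0 \<Longrightarrow> s t = m * sqrt t"
    and "\<And>t x. t > 0 \<Longrightarrow> x \<in> {0..s t} \<Longrightarrow> T x t = quadratic_profile \<Theta> A B s x t"
    and "m\<^sup>2 * (A + B) = 12 * (k / (\<rho> * c)) * B"
    and "k * (A + 2 * B) = h * m * (1 - A - B)"
    and "c * \<Theta> * A\<^sup>2 = 2 * lam * B"
proof -
  have s_pos: "\<And>t. t > 0 \<Longrightarrow> 0 < s t"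
    using sol by (auto simp: quadratic_solution_P4_def)
  obtain A B where AB: "A > 0" "B > 0"
    and T: "\<And>t x. t > 0 \<Longrightarrow> x \<in> {0..s t} \<Longrightarrow> T x t = quadratic_profile \<Theta> A B s x t"
    using sol unfolding quadratic_solution_P4_def by metis
  have "problem_P4 k \<rho> c lam \<Theta> h T s"
    using sol by (simp add: quadratic_solution_P4_def)
  then obtain Tx Txx Tt where
        dx: "\<And>t x. t > 0 \<Longrightarrow> x \<in> {0..s t} \<Longrightarrow>
              ((\<lambda>y. T y t) has_real_derivative Tx x t) (at x within {0..s t})"
    and dxx: "\<And>t x. t > 0 \<Longrightarrow> x \<in> {0..s t} \<Longrightarrow>
              ((\<lambda>y. Tx y t) has_real_derivative Txx x t) (at x within {0..s t})"
    and dt: "\<And>t x. t > 0 \<Longrightarrow> x \<in> {0..s t} \<Longrightarrow>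
              ((\<lambda>\<tau>. T x \<tau>) has_real_derivative Tt x t) (at t within {\<tau>. 0 < \<tau> \<and> x \<le> s \<tau>})"
    and heat: "\<And>t. t > 0 \<Longrightarrow> integral {0..s t} (\<lambda>x. integral {0..x} (\<lambda>\<eta>. Tt \<eta> t))
              = - (k / (\<rho> * c)) * (T 0 t + Tx 0 t * s t)"
    and robin: "\<And>t. t > 0 \<Longrightarrow> k * Tx 0 t = h / sqrt t * (T 0 t + \<Theta>)"
    and stefan: "\<And>t. t > 0 \<Longrightarrow> (Tx (s t) t)\<^sup>2 = - (lam / c) * Txx (s t) t"
    and s0: "s 0 = 0"
    unfolding problem_P4_def by (elim exE conjE) (rule that, blast+)
  \<comment> \<open>Since \<open>s t > 0\<close>, the slice is a nondegenerate interval, so even the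
    one-sided derivatives at its two endpoints are unique.\<close>
  have unique: "D = E"
    if "(f has_real_derivative D) (at x within {0..s t})"
      "(f has_real_derivative E) (at x within {0..s t})" "t > 0" "x \<in> {0..s t}"
    for f D E x t
    by (rule vector_derivative_unique_within_closed_interval[of 0 "s t" x f])
      (use that s_pos in \<open>auto simp: has_real_derivative_iff_has_vector_derivative\<close>)
  have Tx: "Tx x t = \<Theta> * (A + 2 * B * (1 - x / s t)) / s t" if "t > 0" "x \<in> {0..s t}" for x t
  proof -
    have "((\<lambda>y. quadratic_profile \<Theta> A B s y t) has_real_derivative Tx x t) (at x within {0..s t})"
      using has_field_derivative_transform_within[OF dx[OF that], of 1] that T[of t] by simp
    from this quadratic_profile_dx show ?thesis
      by (rule unique) (use s_pos[OF that(1)] that in simp_all)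
  qed
  \<comment> \<open>The formula for \<open>Tx\<close> is known on the whole slice and can therefore
    be differentiated within it.\<close>
  have Txx: "Txx x t = - 2 * B * \<Theta> / (s t)\<^sup>2" if "t > 0" "x \<in> {0..s t}" for x t
  proof -
    have "((\<lambda>y. \<Theta> * (A + 2 * B * (1 - y / s t)) / s t) has_real_derivative Txx x t)
        (at x within {0..s t})"
      using has_field_derivative_transform_within[OF dxx[OF that], of 1] that Tx[of t] by simp
    from this quadratic_profile_dxx[where s = s] show ?thesis
      by (rule unique) (use s_pos[OF that(1)] that in simp_all)
  qed
  have T0: "T 0 t = - (A + B) * \<Theta>" if "t > 0" for t
    using T[of t 0] s_pos[OF that] that by (simp add: quadratic_profile_def algebra_simps)
  \<comment> \<open>\<open>T 0 t\<close> is constant in time and \<open>Tx 0 t\<close> is a constant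
    divided by \<open>s t\<close>, so clearing denominators ties \<open>s t\<close> linearly to
    \<open>sqrt t\<close>.\<close>
  have robin': "sqrt t * k * (A + 2 * B) = h * s t * (1 - A - B)" if "t > 0" for t
  proof -
    have "k * (\<Theta> * (A + 2 * B) / s t) = h / sqrt t * (\<Theta> * (1 - A - B))"
      using robin[OF that] Tx[of t 0] T0[OF that] s_pos[OF that] that by (simp add: algebra_simps)
    then have "\<Theta> * (sqrt t * k * (A + 2 * B)) = \<Theta> * (h * s t * (1 - A - B))"
      using s_pos[OF that] that by (simp add: field_simps)
    then show ?thesis using pos by simp
  qed
  define m where "m = s 1"
  have m: "m > 0" "k * (A + 2 * B) = h * m * (1 - A - B)"
    using robin'[of 1] s_pos[of 1] by (simp_all add: m_def)
  \<comment> \<open>The left side of the Robin equation is positive, so the coefficient of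
    \<open>s t\<close> is nonzero and can be cancelled.\<close>
  have "k * (A + 2 * B) > 0"
    using AB pos by (intro mult_pos_pos) auto
  then have nz: "h * (1 - A - B) \<noteq> 0"
    using m by auto
  have s_eq: "s t = m * sqrt t" if "t \<ge> 0" for t
  proof (cases "t = 0")
    case False
    then have "h * s t * (1 - A - B) = sqrt t * (k * (A + 2 * B))"
      using robin'[of t] that by simp
    then have "h * (1 - A - B) * s t = h * (1 - A - B) * (m * sqrt t)"
      unfolding m(2) by (simp only: ac_simps)
    then show ?thesis using nz by (simp only: mult_cancel_left) simp
  qed (simp add: s0)
  \<comment> \<open>The square root formula for \<open>s\<close> holds at nonnegative times, hence
    on an open neighbourhood of \<open>1\<close>, and differentiating it there is
    legitimate.\<close>
  have ds: "(s has_real_derivative m / 2) (at 1)"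
    by (rule has_field_derivative_transform_within_open[where f = "\<lambda>t. m * sqrt t" and S = "{0<..}"])
      (use has_real_derivative_mult_sqrt[of 1 m] s_eq in auto)
  txt \<open>The heat balance is only needed at \<open>t = 1\<close>. Points \<open>\<eta> < s 1\<close> stay in the region for
    all times close to \<open>1\<close>, so there \<open>Tt\<close> is a two-sided derivative.\<close>
  have Tt: "Tt \<eta> 1 = (- (A + 2 * B) * \<Theta> * (m / 2) / m\<^sup>2) * \<eta> + (2 * B * \<Theta> * (m / 2) / m ^ 3) * \<eta>\<^sup>2"
    if "0 \<le> \<eta>" "\<eta> < m" for \<eta>
  proof -
    define U where "U = {\<tau>. 0 < \<tau> \<and> \<eta> < m * sqrt \<tau>}"
    have "open U"
      unfolding U_def by (intro open_Collect_conj open_Collect_less continuous_intros)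
    have "1 \<in> U" using that by (simp add: U_def)
    have "((\<lambda>\<tau>. T \<eta> \<tau>) has_real_derivative Tt \<eta> 1) (at 1 within U)"
    proof (rule DERIV_subset[OF dt])
      show "U \<subseteq> {\<tau>. 0 < \<tau> \<and> \<eta> \<le> s \<tau>}"
        using s_eq by (auto simp: U_def)
    qed (use that in \<open>simp_all add: m_def\<close>)
    then have "((\<lambda>\<tau>. T \<eta> \<tau>) has_real_derivative Tt \<eta> 1) (at 1)"
      unfolding at_within_open[OF \<open>1 \<in> U\<close> \<open>open U\<close>] .
    then have "((\<lambda>\<tau>. quadratic_profile \<Theta> A B s \<eta> \<tau>) has_real_derivative Tt \<eta> 1) (at 1)"
      by (rule has_field_derivative_transform_within_open[OF _ \<open>open U\<close> \<open>1 \<in> U\<close>])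
        (rule T, use that s_eq in \<open>auto simp: U_def\<close>)
    moreover have "s 1 \<noteq> 0" using m(1) m_def by simp
    ultimately show ?thesis
      unfolding m_def by (intro DERIV_unique[OF _ quadratic_profile_dt[OF ds[unfolded m_def]]])
  qed
  have "- (A + B) * \<Theta> * (m / 2) * m / 6 = - (k / (\<rho> * c)) * (T 0 1 + Tx 0 1 * m)"
    using heat[of 1] quadratic_profile_double_integral(2)[where g = "\<lambda>\<eta>. Tt \<eta> 1", OF m(1) Tt]
    by (simp add: m_def)
  also have "T 0 1 + Tx 0 1 * m = \<Theta> * B"
    using T0[of 1] Tx[of 1 0] m(1) by (simp add: m_def) (simp add: algebra_simps)
  finally have "\<Theta> * (m\<^sup>2 * (A + B)) = \<Theta> * (12 * (k / (\<rho> * c)) * B)"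
    by (simp add: power2_eq_square algebra_simps)
  then have heat': "m\<^sup>2 * (A + B) = 12 * (k / (\<rho> * c)) * B"
    using pos(5) by (simp only: mult_cancel_left) simp
  have "(\<Theta> * A / m)\<^sup>2 = lam / c * (2 * B * \<Theta> / m\<^sup>2)"
    using stefan[of 1] Tx[of 1 m] Txx[of 1 m] m by (simp add: m_def)
  then have "\<Theta> * (c * \<Theta> * A\<^sup>2) = \<Theta> * (2 * lam * B)"
    using m(1) pos by (simp add: field_simps power2_eq_square)
  then have stefan': "c * \<Theta> * A\<^sup>2 = 2 * lam * B"
    using pos by simp
  show thesis
    by (rule that[OF m(1) AB]) (fact s_eq T heat' m(2) stefan')+
qed

section \<open>Solving the algebraic system\<close>

text \<open>The first two equations are linear in \<open>A\<close> and \<open>B\<close> and have a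
  unique solution with denominator \<open>D\<close>; substituted into the third, it gives the
  quartic. Existence uses the equivalence from right to left, uniqueness from left to right.\<close>

lemma quadratic_profile_coefficients_iff:
  fixes Ste Bi \<xi> A B :: real
  assumes pos: "Ste > 0" "Bi > 0" "\<xi> > 0"
  defines "D \<equiv> 1 / Bi * \<xi>\<^sup>2 + 6 * \<xi> + 3 / Bi"
  shows "\<xi>\<^sup>2 * (A + B) = 3 * B \<and> A + 2 * B = 2 * \<xi> * Bi * (1 - A - B) \<and> Ste * A\<^sup>2 = 2 * B \<longleftrightarrow>
    A = 2 * \<xi> * (3 - \<xi>\<^sup>2) / D \<and> B = 2 * \<xi> ^ 3 / D \<and> quartic_P4 Ste Bi \<xi> = 0"
proof -
  have D: "D > 0"
    unfolding D_def using pos by (intro add_pos_pos) auto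
  have BiD: "Bi * D = \<xi>\<^sup>2 + 6 * \<xi> * Bi + 3"
    unfolding D_def using pos by (simp add: field_simps)
  have eqA: "A = 2 * \<xi> * (3 - \<xi>\<^sup>2) / D \<longleftrightarrow> D * A = 2 * \<xi> * (3 - \<xi>\<^sup>2)"
    and eqB: "B = 2 * \<xi> ^ 3 / D \<longleftrightarrow> D * B = 2 * \<xi> ^ 3"
    using D by (auto simp: field_simps)
  have lin: "\<xi>\<^sup>2 * (A + B) = 3 * B \<and> A + 2 * B = 2 * \<xi> * Bi * (1 - A - B) \<longleftrightarrow>
      D * A = 2 * \<xi> * (3 - \<xi>\<^sup>2) \<and> D * B = 2 * \<xi> ^ 3" (is "?L \<longleftrightarrow> ?R")
  proof
    assume ?L
    then have h: "\<xi>\<^sup>2 * (A + B) = 3 * B" "A + 2 * B = 2 * \<xi> * Bi * (1 - A - B)"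
      by auto
    \<comment> \<open>Multiplying the second equation by \<open>\<xi>^2\<close> and inserting the
      first eliminates \<open>A\<close>.\<close>
    have "Bi * D * B = Bi * (2 * \<xi> ^ 3)"
      unfolding BiD using h by algebra
    then have b: "D * B = 2 * \<xi> ^ 3"
      using pos by simp
    \<comment> \<open>The first equation determines only \<open>\<xi>^2 * A\<close> in terms of
      \<open>B\<close>; the factor is cancelled afterwards because \<xi> is positive.\<close>
    have "\<xi>\<^sup>2 * (D * A) = \<xi>\<^sup>2 * (2 * \<xi> * (3 - \<xi>\<^sup>2))"
      using b h(1) by algebra
    then show ?R using b pos by simp
  next
    assume ?R
    then have h: "D * A = 2 * \<xi> * (3 - \<xi>\<^sup>2)" "D * B = 2 * \<xi> ^ 3"
      by auto
    have "D * (\<xi>\<^sup>2 * (A + B)) = D * (3 * B)"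
      using h by algebra
    moreover have "D * (A + 2 * B) = D * (2 * \<xi> * Bi * (1 - A - B))"
      using h BiD by algebra
    ultimately show ?L using D by simp
  qed
  have "Ste * A\<^sup>2 = 2 * B \<longleftrightarrow> quartic_P4 Ste Bi \<xi> = 0"
    if h: "D * A = 2 * \<xi> * (3 - \<xi>\<^sup>2)" "D * B = 2 * \<xi> ^ 3"
  proof -
    \<comment> \<open>Everything in the quartic besides the square is \<open>- \<xi> * D\<close>,
      which matches \<open>2 * B\<close> after multiplication by \<open>D^2\<close>, up to the
      common factor \<open>4 * \<xi>^2\<close>.\<close>
    have q: "quartic_P4 Ste Bi \<xi> = Ste * (3 - \<xi>\<^sup>2)\<^sup>2 - \<xi> * D"
      unfolding quartic_P4_alt D_def using pos by (simp add: field_simps power2_eq_square power3_eq_cube)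
    have "D\<^sup>2 * (Ste * A\<^sup>2 - 2 * B) = 4 * \<xi>\<^sup>2 * quartic_P4 Ste Bi \<xi>"
      unfolding q using h by algebra
    then show ?thesis
      using D pos by (metis eq_iff_diff_eq_0 less_irrefl mult_eq_0_iff power2_eq_square
          zero_neq_numeral)
  qed
  then show ?thesis unfolding eqA eqB using lin by blast
qed

section \<open>Dimensionless form, existence and uniqueness\<close>

theorem theorem3p4:
  fixes k \<rho> c lam \<Theta> h \<alpha> Ste Bi :: real
  assumes "k > 0" "\<rho> > 0" "c > 0" "lam > 0" "\<Theta> > 0" "h > 0"
    and "\<alpha> = k / (\<rho> * c)"
    and "Ste = c * \<Theta> / lam"
    and "Bi = h * sqrt \<alpha> / k"
  shows "(\<exists>!z. 0 < z \<and> z < sqrt 3 \<and> quartic_P4 Ste Bi z = 0) \<and>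
    (\<forall>\<xi>. 0 < \<xi> \<and> \<xi> < sqrt 3 \<and> quartic_P4 Ste Bi \<xi> = 0 \<longrightarrow>
      (let A4 = 2 * \<xi> * (3 - \<xi>\<^sup>2) / (1 / Bi * \<xi>\<^sup>2 + 6 * \<xi> + 3 / Bi);
           B4 = 2 * \<xi> ^ 3 / (1 / Bi * \<xi>\<^sup>2 + 6 * \<xi> + 3 / Bi);
           s4 = (\<lambda>t. 2 * \<xi> * sqrt (\<alpha> * t));
           T4 = quadratic_profile \<Theta> A4 B4 s4
       in A4 > 0 \<and> B4 > 0 \<and>
          quadratic_solution_P4 k \<rho> c lam \<Theta> h T4 s4 \<and>
          (\<forall>T s. quadratic_solution_P4 k \<rho> c lam \<Theta> h T s \<longrightarrow>
             (\<forall>t\<ge>0. s t = s4 t) \<and>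
             (\<forall>t>0. \<forall>x\<in>{0..s4 t}. T x t = T4 x t))))"
proof -
  have \<alpha>: "\<alpha> > 0" and Ste: "Ste > 0" and Bi: "Bi > 0"
    using assms by simp_all
  \<comment> \<open>For \<open>m = 2 * \<xi> * sqrt \<alpha>\<close> the three physical equations
    are the dimensionless ones multiplied by \<open>lam\<close>, \<open>4 * \<alpha>\<close> and
    \<open>k\<close> respectively, all nonzero.\<close>
  have stefan: "c * \<Theta> * A\<^sup>2 = 2 * lam * B \<longleftrightarrow> Ste * A\<^sup>2 = 2 * B"
    for A B
  proof -
    have "c * \<Theta> * A\<^sup>2 = lam * (Ste * A\<^sup>2)" "2 * lam * B = lam * (2 * B)"
      using assms by simp_all
    then show ?thesis using assms(4) by (simp only: mult_cancel_left) simp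
  qed
  have heat: "(2 * \<xi> * sqrt \<alpha>)\<^sup>2 * (A + B) = 12 * (k / (\<rho> * c)) * B \<longleftrightarrow> \<xi>\<^sup>2 * (A + B) = 3 * B"
    for \<xi> A B
  proof -
    have "(2 * \<xi> * sqrt \<alpha>)\<^sup>2 * (A + B) - 12 * (k / (\<rho> * c)) * B = 4 * \<alpha> * (\<xi>\<^sup>2 * (A + B) - 3 * B)"
      using \<alpha> by (simp add: assms(7)[symmetric] power_mult_distrib algebra_simps)
    then show ?thesis
      using \<alpha> by (metis eq_iff_diff_eq_0 less_irrefl mult_eq_0_iff zero_neq_numeral)
  qed
  have robin: "k * (A + 2 * B) = h * (2 * \<xi> * sqrt \<alpha>) * (1 - A - B) \<longleftrightarrow>
      A + 2 * B = 2 * \<xi> * Bi * (1 - A - B)" for \<xi> A B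
  proof -
    have "h * sqrt \<alpha> = k * Bi"
      using assms by simp
    then have "h * (2 * \<xi> * sqrt \<alpha>) * (1 - A - B) = k * (2 * \<xi> * Bi * (1 - A - B))"
      by algebra
    then show ?thesis using assms(1) by (simp only: mult_cancel_left) simp
  qed
  have uniq: "\<exists>!z. 0 < z \<and> z < sqrt 3 \<and> quartic_P4 Ste Bi z = 0"
    by (rule quartic_P4_ex1[OF Ste Bi])
  show ?thesis
  proof (intro conjI allI impI)
    fix \<xi> assume \<xi>: "0 < \<xi> \<and> \<xi> < sqrt 3 \<and> quartic_P4 Ste Bi \<xi> = 0"
    define D where "D = 1 / Bi * \<xi>\<^sup>2 + 6 * \<xi> + 3 / Bi"
    define A4 where "A4 = 2 * \<xi> * (3 - \<xi>\<^sup>2) / D"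
    define B4 where "B4 = 2 * \<xi> ^ 3 / D"
    define s4 where "s4 = (\<lambda>t. 2 * \<xi> * sqrt (\<alpha> * t))"
    \<comment> \<open>This exhibits \<open>s4\<close> as \<open>m * sqrt t\<close> with
      \<open>m = 2 * \<xi> * sqrt \<alpha>\<close>.\<close>
    have s4: "s4 = (\<lambda>t. 2 * \<xi> * sqrt \<alpha> * sqrt t)"
      by (simp add: s4_def real_sqrt_mult mult.assoc)
    have D: "D > 0"
      unfolding D_def using \<xi> Bi by (intro add_pos_pos) auto
    have "\<xi>\<^sup>2 < 3"
      using \<xi> power_strict_mono[of \<xi> "sqrt 3" 2] by simp
    then have A4: "A4 > 0" and B4: "B4 > 0"
      using \<xi> D by (simp_all add: A4_def B4_def)
    have eqs: "(2 * \<xi> * sqrt \<alpha>)\<^sup>2 * (A4 + B4) = 12 * (k / (\<rho> * c)) * B4 \<and>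
        k * (A4 + 2 * B4) = h * (2 * \<xi> * sqrt \<alpha>) * (1 - A4 - B4) \<and> c * \<Theta> * A4\<^sup>2 = 2 * lam * B4"
      unfolding heat robin stefan A4_def B4_def D_def
      by (rule quadratic_profile_coefficients_iff[OF Ste Bi, THEN iffD2]) (use \<xi> in simp_all)
    have "2 * \<xi> * sqrt \<alpha> > 0"
      using \<xi> \<alpha> by simp
    then have sol: "quadratic_solution_P4 k \<rho> c lam \<Theta> h (quadratic_profile \<Theta> A4 B4 s4) s4"
      unfolding s4 using eqs A4 B4 by (intro quadratic_solution_P4_sqrt assms(1-5)) blast+
    have "(\<forall>t\<ge>0. s t = s4 t) \<and> (\<forall>t>0. \<forall>x\<in>{0..s4 t}. T x t = quadratic_profile \<Theta> A4 B4 s4 x t)"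
      if "quadratic_solution_P4 k \<rho> c lam \<Theta> h T s" for T s
    proof -
      from quadratic_solution_P4E[OF assms(1-6) that] obtain m A B where
        m: "m > 0" and AB: "A > 0" "B > 0"
        and s: "\<And>t. t \<ge> 0 \<Longrightarrow> s t = m * sqrt t"
        and T: "\<And>t x. t > 0 \<Longrightarrow> x \<in> {0..s t} \<Longrightarrow> T x t = quadratic_profile \<Theta> A B s x t"
        and eqs: "m\<^sup>2 * (A + B) = 12 * (k / (\<rho> * c)) * B"
          "k * (A + 2 * B) = h * m * (1 - A - B)" "c * \<Theta> * A\<^sup>2 = 2 * lam * B"
        by blast
      \<comment> \<open>This inverts \<open>m = 2 * z * sqrt \<alpha>\<close>, making
        \<open>z\<close> the candidate root attached to an arbitrary solution.\<close>
      define z where "z = m / (2 * sqrt \<alpha>)"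
      have z: "z > 0" and mz: "m = 2 * z * sqrt \<alpha>"
        using m \<alpha> by (simp_all add: z_def)
      have alg: "z\<^sup>2 * (A + B) = 3 * B" "A + 2 * B = 2 * z * Bi * (1 - A - B)" "Ste * A\<^sup>2 = 2 * B"
        using eqs unfolding mz heat robin stefan by auto
      \<comment> \<open>Positivity of \<open>A\<close> gives \<open>B < A + B\<close>; this confines
        \<open>z\<close> to the interval in which the root is unique.\<close>
      have "z\<^sup>2 * (A + B) < 3 * (A + B)"
        unfolding alg(1) using AB by simp
      then have "z\<^sup>2 < 3"
        by (rule mult_right_less_imp_less) (use AB in simp)
      then have "z < sqrt 3"
        by (rule real_less_rsqrt)
      moreover have root: "A = 2 * z * (3 - z\<^sup>2) / (1 / Bi * z\<^sup>2 + 6 * z + 3 / Bi) \<and>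
          B = 2 * z ^ 3 / (1 / Bi * z\<^sup>2 + 6 * z + 3 / Bi) \<and> quartic_P4 Ste Bi z = 0"
        using alg by (intro quadratic_profile_coefficients_iff[OF Ste Bi z, THEN iffD1]) blast
      ultimately have "z = \<xi>"
        using uniq \<xi> z by blast
      then have "A = A4" "B = B4" and s_eq: "\<And>t. t \<ge> 0 \<Longrightarrow> s t = s4 t"
        using root s mz by (simp_all add: A4_def B4_def D_def s4)
      \<comment> \<open>The two free boundaries coincide, so the regions and the normalized
        variables \<open>x / s t\<close> coincide as well.\<close>
      then show ?thesis
        using T by (simp add: quadratic_profile_def)
    qed
    with A4 B4 sol show "let A4 = 2 * \<xi> * (3 - \<xi>\<^sup>2) / (1 / Bi * \<xi>\<^sup>2 + 6 * \<xi> + 3 / Bi);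
           B4 = 2 * \<xi> ^ 3 / (1 / Bi * \<xi>\<^sup>2 + 6 * \<xi> + 3 / Bi);
           s4 = (\<lambda>t. 2 * \<xi> * sqrt (\<alpha> * t));
           T4 = quadratic_profile \<Theta> A4 B4 s4
       in A4 > 0 \<and> B4 > 0 \<and>
          quadratic_solution_P4 k \<rho> c lam \<Theta> h T4 s4 \<and>
          (\<forall>T s. quadratic_solution_P4 k \<rho> c lam \<Theta> h T s \<longrightarrow>
             (\<forall>t\<ge>0. s t = s4 t) \<and>
             (\<forall>t>0. \<forall>x\<in>{0..s4 t}. T x t = T4 x t))"
      unfolding Let_def A4_def B4_def D_def s4_def by blast
  qed (rule uniq)
qed

end
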